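(* Let $P\in\mathbb{D}\mathbb{H}[t]$ be a generic motion polynomial of degree $n>0$, and let $M_1,\dots,M_n\in\mathbb{R}[t]$ be the $n$ distinct monic quadratic irreducible factors of $P\overline{P}$. Then there is a one-to-one correspondence between factorizations $P(t)=(t-h_1)\cdots(t-h_n)$ into linear polynomials over $\mathbb{D}\mathbb{H}$ (i.e. tuples $(h_1,\dots,h_n)\in\mathbb{D}\mathbb{H}^n$ with this property) and permutations $\sigma$ of $\{1,\dots,n\}$, such that the factorization corresponding to $\sigma$ satisfies $M_{\sigma(i)}(h_i)=0$ for $i=1,\dots,n$. That is: for every permutation $\sigma$ there is exactly one factorization $P=(t-h_1)\cdots(t-h_n)$ with $h_i\in\mathbb{D}\mathbb{H}$ and $M_{\sigma(i)}(h_i)=0$ for all $i$, and every factorization $P=(t-h_1)\cdots(t-h_n)$ with $h_i\in\mathbb{D}\mathbb{H}$ satisfies $M_{\sigma(i)}(h_i)=0$ for all $i$ for exactly one permutation $\sigma$.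
   Context: Let $\mathbb{D}=\mathbb{R}+\epsilon\mathbb{R}$ with $\epsilon^2=0$ be the ring of dual numbers, $\mathbb{H}$ the real quaternions, and $\mathbb{D}\mathbb{H}$ the algebra of quaternions with coefficients in $\mathbb{D}$ ($\epsilon$ is central). The conjugate $\overline{h}$ of $h\in\mathbb{D}\mathbb{H}$ is obtained by multiplying its vectorial part (the $\mathbf{i},\mathbf{j},\mathbf{k}$ components, in $\mathbb{D}^3$) by $-1$. $\mathbb{D}\mathbb{H}[t]$ is the ring of polynomials over $\mathbb{D}\mathbb{H}$ in which the indeterminate $t$ commutes with all coefficients; for $P=\sum a_it^i$ put $\overline{P}=\sum\overline{a_i}t^i$, and for $h\in\mathbb{D}\mathbb{H}$ put $P(h)=\sum a_ih^i$ (coefficients on the left). A motion polynomial is a monic $P\in\mathbb{D}\mathbb{H}[t]$ with $P\overline{P}\in\mathbb{R}[t]$. A motion polynomial $P$ of degree $n>0$ is generic if $P\overline{P}$ has $n$ distinct monic quadratic factors that are irreducible over $\mathbb{R}$, i.e. $P\overline{P}=M_1\cdots M_n$ with pairwise distinct monic irreducible quadratic $M_i\in\mathbb{R}[t]$. *)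

theory Defs
  imports
    Complex_Main
    "HOL-Library.Poly_Mapping"
    "HOL-Computational_Algebra.Polynomial"
    "HOL-Computational_Algebra.Factorial_Ring"
    "HOL-Combinatorics.Permutations"
begin

section \<open>Dual numbers\<close>

text \<open>\<open>Dual a b\<close> is \<open>a + \<epsilon> b\<close> with \<open>\<epsilon>\<^sup>2 = 0\<close>.\<close>

datatype dual = Dual (primal: real) (dual_part: real)

instantiation dual :: "{comm_ring_1, real_algebra_1}"
begin

definition "0 = Dual 0 0"
definition "1 = Dual 1 0"
definition "x + y = Dual (primal x + primal y) (dual_part x + dual_part y)"
definition "x - y = Dual (primal x - primal y) (dual_part x - dual_part y)"
definition "- x = Dual (- primal x) (- dual_part x)"
definition "x * y = Dual (primal x * primal y) (primal x * dual_part y + dual_part x * primal y)"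
definition "scaleR r x = Dual (r * primal x) (r * dual_part x)"

instance
  by standard
    (auto simp: zero_dual_def one_dual_def plus_dual_def minus_dual_def uminus_dual_def
      times_dual_def scaleR_dual_def algebra_simps)

end

section \<open>Quaternions over a commutative ring\<close>

text \<open>\<open>Quat a b c d\<close> is \<open>a + b i + c j + d k\<close>.\<close>

datatype 'a quat = Quat (q0: 'a) (q1: 'a) (q2: 'a) (q3: 'a)

instantiation quat :: (comm_ring_1) ring_1
begin

definition "0 = Quat 0 0 0 0"
definition "1 = Quat 1 0 0 0"
definition "x + y = Quat (q0 x + q0 y) (q1 x + q1 y) (q2 x + q2 y) (q3 x + q3 y)"
definition "x - y = Quat (q0 x - q0 y) (q1 x - q1 y) (q2 x - q2 y) (q3 x - q3 y)"
definition "- x = Quat (- q0 x) (- q1 x) (- q2 x) (- q3 x)"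
definition "x * y = Quat
  (q0 x * q0 y - q1 x * q1 y - q2 x * q2 y - q3 x * q3 y)
  (q0 x * q1 y + q1 x * q0 y + q2 x * q3 y - q3 x * q2 y)
  (q0 x * q2 y - q1 x * q3 y + q2 x * q0 y + q3 x * q1 y)
  (q0 x * q3 y + q1 x * q2 y - q2 x * q1 y + q3 x * q0 y)"

instance
  by standard
    (auto simp: zero_quat_def one_quat_def plus_quat_def minus_quat_def uminus_quat_def
      times_quat_def algebra_simps)

end

instantiation quat :: ("{comm_ring_1, real_algebra_1}") real_algebra_1
begin

definition "scaleR r x = Quat (r *\<^sub>R q0 x) (r *\<^sub>R q1 x) (r *\<^sub>R q2 x) (r *\<^sub>R q3 x)"

instance
  by standard
    (auto simp: plus_quat_def times_quat_def scaleR_quat_def algebra_simps)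

end

definition qconj :: "'a::comm_ring_1 quat \<Rightarrow> 'a quat" where
  "qconj h = Quat (q0 h) (- q1 h) (- q2 h) (- q3 h)"

type_synonym dquat = "dual quat"

section \<open>Polynomials with a central indeterminate over a noncommutative ring\<close>

text \<open>
  The type \<^typ>\<open>'a poly\<close> is a ring only for commutative \<^typ>\<open>'a\<close>. Finitely supported
  functions \<^typ>\<open>nat \<Rightarrow>\<^sub>0 'a\<close> with the convolution product form a ring for every ring
  \<^typ>\<open>'a\<close>; \<open>Poly_Mapping.single k c\<close> is \<open>c t\<^sup>k\<close>.
\<close>

type_synonym 'a ncpoly = "nat \<Rightarrow>\<^sub>0 'a"

definition Const :: "'a::zero \<Rightarrow> 'a ncpoly" where
  "Const c = Poly_Mapping.single 0 c"

definition Indet :: "'a::zero_neq_one ncpoly" where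
  "Indet = Poly_Mapping.single 1 1"

text \<open>This differs from \<open>Poly_Mapping.degree\<close>, which is the degree plus one on nonzero polynomials.\<close>

definition nc_degree :: "'a::zero ncpoly \<Rightarrow> nat" where
  "nc_degree P = Max (insert 0 (Poly_Mapping.keys P))"

definition nc_monic :: "'a::zero_neq_one ncpoly \<Rightarrow> bool" where
  "nc_monic P \<longleftrightarrow> Poly_Mapping.lookup P (nc_degree P) = 1"

text \<open>Evaluation with the coefficients on the left; it is not multiplicative in \<open>P\<close>.\<close>

definition nc_eval :: "'a::ring_1 ncpoly \<Rightarrow> 'a \<Rightarrow> 'a" where
  "nc_eval P h = (\<Sum>i\<in>Poly_Mapping.keys P. Poly_Mapping.lookup P i * h ^ i)"

definition nc_conj :: "'a::comm_ring_1 quat ncpoly \<Rightarrow> 'a quat ncpoly" where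
  "nc_conj P = Poly_Mapping.map qconj P"

text \<open>The inclusion of the real polynomials.\<close>

lift_definition of_real_poly :: "real poly \<Rightarrow> 'a::real_algebra_1 ncpoly"
  is "\<lambda>p i. of_real (Polynomial.coeff p i)"
proof -
  fix p :: "real poly"
  have "{i. (of_real (Polynomial.coeff p i) :: 'a) \<noteq> 0} \<subseteq> {..Polynomial.degree p}"
    using le_degree by auto
  then show "finite {i. (of_real (Polynomial.coeff p i) :: 'a) \<noteq> 0}"
    by (rule finite_subset) simp
qed

section \<open>Motion polynomials\<close>

definition motion_polynomial :: "dquat ncpoly \<Rightarrow> bool" where
  "motion_polynomial P \<longleftrightarrow> nc_monic P \<and> P * nc_conj P \<in> range of_real_poly"

text \<open>
  \<open>M 0, \<dots>, M (n - 1)\<close>, with \<open>n\<close> the degree of \<open>P\<close>, are the distinct monic irreducible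
  quadratic factors of the norm polynomial of \<open>P\<close>.
\<close>

definition quadratic_factors :: "dquat ncpoly \<Rightarrow> (nat \<Rightarrow> real poly) \<Rightarrow> bool" where
  "quadratic_factors P M \<longleftrightarrow>
     (\<forall>i<nc_degree P. lead_coeff (M i) = 1 \<and> Polynomial.degree (M i) = 2 \<and> irreducible (M i)) \<and>
     inj_on M {..<nc_degree P} \<and>
     P * nc_conj P = of_real_poly (\<Prod>i<nc_degree P. M i)"

definition generic_motion_polynomial :: "dquat ncpoly \<Rightarrow> bool" where
  "generic_motion_polynomial P \<longleftrightarrow>
     motion_polynomial P \<and> nc_degree P > 0 \<and> (\<exists>M. quadratic_factors P M)"

definition linear_factorization :: "dquat ncpoly \<Rightarrow> dquat list \<Rightarrow> bool" where
  "linear_factorization P hs \<longleftrightarrow>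
     length hs = nc_degree P \<and> P = prod_list (map (\<lambda>h. Indet - Const h) hs)"

definition roots_along :: "(nat \<Rightarrow> real poly) \<Rightarrow> (nat \<Rightarrow> nat) \<Rightarrow> dquat list \<Rightarrow> bool" where
  "roots_along M \<sigma> hs \<longleftrightarrow>
     (\<forall>i<length hs. nc_eval (of_real_poly (M (\<sigma> i))) (hs ! i) = 0)"

end

theory Submission
  imports
    Defs
    "HOL-Computational_Algebra.Polynomial_Factorial"
    "HOL-Computational_Algebra.Field_as_Ring"
begin

text \<open>
  A factorization is built by splitting off linear factors on the right. Let \<open>m\<close> be a
  monic real quadratic with \<open>P \<cdot> conj P = N \<cdot> m\<close> and \<open>m\<close> coprime to the real polynomial \<open>N\<close>.
  Division by the central polynomial \<open>m\<close> gives \<open>P = T m + R\<close> with \<open>R = a t + b\<close>, and \<open>m\<close> divides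
  \<open>R \<cdot> conj R\<close>; comparing degrees, \<open>R \<cdot> conj R = a \<cdot> conj a \<cdot> m\<close>. The coefficient \<open>a\<close> is invertible:
  otherwise its primal part and then that of \<open>b\<close> vanish, so the primal part of \<open>P\<close> is divisible by
  \<open>m\<close> and that of the norm polynomial by \<open>m\<^sup>2\<close>, against coprimality (\<open>not_primal_divisible\<close>).
  Hence \<open>R = a (t - h)\<close> with \<open>h = - a\<^sup>-\<^sup>1 b\<close>, and \<open>(t - h) (t - conj h) = m\<close>, so \<open>t - h\<close>
  is a right factor of \<open>m\<close> and therefore of \<open>P\<close>. Conversely, a right factor \<open>t - h'\<close> of \<open>P\<close> with
  \<open>m(h') = 0\<close> is also a right factor of \<open>R\<close>, which forces \<open>h' = h\<close>. This is \<open>linear_right_factor\<close>;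
  the remaining left factor is monic, unique, and has norm polynomial \<open>N\<close>. Induction gives exactly
  one factorization for every ordering of the quadratic factors (\<open>ex1_ordered_factorization\<close>).

  It remains to see that every factorization arises from an ordering. The norms
  \<open>(t - h\<^sub>i) (t - conj h\<^sub>i)\<close> are a priori polynomials \<open>p\<^sub>i + \<epsilon> q\<^sub>i\<close> over the dual numbers, with real
  \<open>p\<^sub>i\<close>, \<open>q\<^sub>i\<close>, and their product is the given squarefree product of real irreducible quadratics. By
  unique factorization each \<open>p\<^sub>i\<close> is one of these quadratics. The dual part of the product reads
  \<open>p B + q A = 0\<close>, where \<open>p + \<epsilon> q\<close> is the first norm and \<open>A + \<epsilon> B\<close> the product of the others;
  as \<open>p\<close> is coprime to \<open>A\<close> and \<open>deg q < deg p\<close>, this forces \<open>q = 0\<close> and \<open>B = 0\<close>, and one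
  continues by induction (\<open>factorization_norms\<close>). The ordering is unique since a dual
  quaternion cannot annul two coprime real polynomials (\<open>irr_quadratic_no_common_root\<close>).
\<close>

section \<open>Coefficients and degrees over a noncommutative ring\<close>

text \<open>The coefficient of \<open>t\<^sup>k\<close> in \<open>P\<close> is \<open>coef P k\<close>.\<close>

abbreviation coef :: "'a::zero ncpoly \<Rightarrow> nat \<Rightarrow> 'a" where
  "coef \<equiv> Poly_Mapping.lookup"

lemma ncpoly_induct [case_names zero add single]:
  assumes "Pr 0" and "\<And>P Q. Pr P \<Longrightarrow> Pr Q \<Longrightarrow> Pr (P + Q)" and "\<And>k c. Pr (Poly_Mapping.single k c)"
  shows "Pr (P :: 'a::monoid_add ncpoly)"
proof (induction P rule: update_induct)
  case const
  then show ?case using assms(1) by simp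
next
  case (update f a b)
  have "Poly_Mapping.update a b f = Poly_Mapping.single a b + f"
    using update(1) by (intro poly_mapping_eqI)
      (auto simp: lookup_update lookup_add lookup_single when_def in_keys_iff)
  then show ?case using assms(2)[OF assms(3) update(3)] by simp
qed

lemma coef_single_mult:
  "coef (Poly_Mapping.single i c * Q) k = (if i \<le> k then c * coef Q (k - i) else 0)"
  for Q :: "'a::ring_1 ncpoly"
proof (induction Q rule: ncpoly_induct)
  case (add P Q)
  then show ?case by (simp add: distrib_left lookup_add)
next
  case (single j d)
  then show ?case by (auto simp: mult_single lookup_single when_def)
qed simp

lemma coef_mult: "coef (P * Q) k = (\<Sum>i\<le>k. coef P i * coef Q (k - i))"
  for P Q :: "'a::ring_1 ncpoly"
proof (induction P rule: ncpoly_induct)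
  case (add P1 P2)
  then show ?case by (simp add: distrib_right lookup_add sum.distrib)
next
  case (single j d)
  have "(\<Sum>i\<le>k. coef (Poly_Mapping.single j d) i * coef Q (k - i))
      = (\<Sum>i\<le>k. if i = j then d * coef Q (k - j) else 0)"
    by (rule sum.cong) (auto simp: lookup_single when_def)
  then show ?case by (simp add: coef_single_mult)
qed simp

lemma coef_Const_mult [simp]: "coef (Const c * P) k = c * coef P k"
  for P :: "'a::ring_1 ncpoly"
  by (simp add: Const_def coef_single_mult)

lemma coef_Const: "coef (Const c) k = (if k = 0 then c else 0)"
  by (simp add: Const_def lookup_single when_def)

lemma coef_Indet: "coef Indet k = (if k = 1 then 1 else 0)"
  by (simp add: Indet_def lookup_single when_def)

lemma coef_mult_Const [simp]: "coef (P * Const c) k = coef P k * c"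
  for P :: "'a::ring_1 ncpoly"
proof -
  have "coef (P * Const c) k = (\<Sum>i\<le>k. if i = k then coef P k * c else 0)"
    unfolding coef_mult by (rule sum.cong) (auto simp: coef_Const)
  then show ?thesis by simp
qed

lemma coef_Indet_mult_Suc [simp]: "coef (Indet * P) (Suc k) = coef P k"
  for P :: "'a::ring_1 ncpoly"
  by (simp add: Indet_def coef_single_mult)

lemma coef_Indet_mult_0 [simp]: "coef (Indet * P) 0 = 0"
  for P :: "'a::ring_1 ncpoly"
  by (simp add: Indet_def coef_single_mult)

lemma Indet_commute: "P * Indet = Indet * P" for P :: "'a::ring_1 ncpoly"
proof (induction P rule: ncpoly_induct)
  case (single k c)
  then show ?case by (simp add: Indet_def mult_single)
qed (simp_all add: algebra_simps)

lemma Const_0 [simp]: "Const 0 = 0"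
  and Const_1 [simp]: "Const (1 :: 'a::ring_1) = 1"
  and Const_add: "Const (a + b :: 'a) = Const a + Const b"
  and Const_minus: "Const (- a :: 'a) = - Const a"
  and Const_diff: "Const (a - b :: 'a) = Const a - Const b"
  and Const_mult: "Const (a * b :: 'a) = Const a * Const b"
  by (simp_all add: Const_def single_add single_uminus single_diff mult_single)

lemma Const_eq_0_iff [simp]: "Const c = 0 \<longleftrightarrow> c = 0"
  by (metis Const_def lookup_single_eq lookup_zero single_zero)

text \<open>
  \<open>P\<close> is monic of degree \<open>n\<close>. This combines \<open>nc_monic\<close> with the value of \<open>nc_degree\<close> into a
  condition on the coefficients alone.
\<close>

definition monic_deg :: "nat \<Rightarrow> 'a::ring_1 ncpoly \<Rightarrow> bool" where
  "monic_deg n P \<longleftrightarrow> coef P n = 1 \<and> (\<forall>k>n. coef P k = 0)"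

lemma monic_deg_iff: "monic_deg n P \<longleftrightarrow> nc_monic P \<and> nc_degree P = n"
proof -
  have above: "coef P k = 0" if "k > nc_degree P" for k
  proof -
    have "k \<notin> Poly_Mapping.keys P"
      using that unfolding nc_degree_def by (auto simp: not_le)
    then show ?thesis by (simp add: in_keys_iff)
  qed
  show ?thesis
  proof
    assume P: "monic_deg n P"
    have deg: "nc_degree P = n"
      unfolding nc_degree_def
    proof (rule Max_eqI)
      show "n \<in> insert 0 (Poly_Mapping.keys P)"
        using P by (simp add: monic_deg_def in_keys_iff)
      show "k \<le> n" if "k \<in> insert 0 (Poly_Mapping.keys P)" for k
        using P that unfolding monic_deg_def in_keys_iff insert_iff by (metis leI le0)
    qed simp
    show "nc_monic P \<and> nc_degree P = n"
      using P unfolding nc_monic_def deg monic_deg_def by simp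
  next
    assume "nc_monic P \<and> nc_degree P = n"
    then show "monic_deg n P"
      using above by (metis monic_deg_def nc_monic_def)
  qed
qed

lemma nonzero_top_coef:
  assumes "P \<noteq> 0"
  obtains d where "coef P d \<noteq> 0" "\<And>k. k > d \<Longrightarrow> coef P k = 0"
proof -
  let ?d = "Max (Poly_Mapping.keys P)"
  have ne: "Poly_Mapping.keys P \<noteq> {}" using assms by simp
  show thesis
  proof (rule that)
    show "coef P ?d \<noteq> 0" using Max_in[OF finite_keys ne] by (simp add: in_keys_iff)
    show "coef P k = 0" if "k > ?d" for k
      using Max_ge[OF finite_keys, of k P] that by (meson in_keys_iff leD)
  qed
qed

lemma coef_mult_top:
  fixes P Q :: "'a::ring_1 ncpoly"
  assumes "\<And>k. k > m \<Longrightarrow> coef P k = 0" "\<And>k. k > n \<Longrightarrow> coef Q k = 0"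
  shows "coef (P * Q) (m + n) = coef P m * coef Q n"
    and "k > m + n \<Longrightarrow> coef (P * Q) k = 0"
proof -
  have "coef (P * Q) (m + n) = (\<Sum>i\<le>m+n. if i = m then coef P m * coef Q n else 0)"
    unfolding coef_mult
  proof (rule sum.cong)
    fix i
    show "coef P i * coef Q (m + n - i) = (if i = m then coef P m * coef Q n else 0)"
      using assms(1)[of i] assms(2)[of "m + n - i"] by (cases i m rule: linorder_cases) auto
  qed simp
  then show "coef (P * Q) (m + n) = coef P m * coef Q n" by simp
  show "coef (P * Q) k = 0" if "k > m + n"
    unfolding coef_mult
  proof (rule sum.neutral, rule ballI)
    fix i
    show "coef P i * coef Q (k - i) = 0"
      using assms(1)[of i] assms(2)[of "k - i"] that by (cases "i > m") auto
  qed
qed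

lemma monic_deg_linear: "monic_deg 1 (Indet - Const h)"
  by (auto simp: monic_deg_def lookup_minus coef_Indet coef_Const)

text \<open>
  This is the uniqueness of division with remainder by a monic polynomial on the right. It holds
  in the presence of zero divisors, since a nonzero \<open>D\<close> passes its leading coefficient on to the
  product.
\<close>

lemma mult_monic_eq_0:
  assumes "monic_deg n A" "\<And>k. k \<ge> n \<Longrightarrow> coef (D * A) k = 0"
  shows "D = 0"
proof (rule ccontr)
  assume "D \<noteq> 0"
  then obtain d where "coef D d \<noteq> 0" "\<And>k. k > d \<Longrightarrow> coef D k = 0"
    by (rule nonzero_top_coef) blast
  moreover from this have "coef (D * A) (d + n) = coef D d"
    using assms(1) by (subst coef_mult_top) (auto simp: monic_deg_def)
  ultimately show False using assms(2)[of "d + n"] by simp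
qed

lemma monic_right_cancel:
  assumes "monic_deg n A" "B * A = C * A"
  shows "B = C"
  using mult_monic_eq_0[OF assms(1), of "B - C"] assms(2) by (simp add: left_diff_distrib)

lemma monic_deg_left_factor:
  assumes "monic_deg n A" "monic_deg (m + n) (Q * A)"
  shows "monic_deg m Q"
proof -
  have "Q \<noteq> 0" using assms(2) by (auto simp: monic_deg_def)
  then obtain d where d: "coef Q d \<noteq> 0" "\<And>k. k > d \<Longrightarrow> coef Q k = 0"
    by (rule nonzero_top_coef) blast
  have A: "coef A n = 1" "\<And>k. k > n \<Longrightarrow> coef A k = 0"
    using assms(1) by (auto simp: monic_deg_def)
  have top: "coef (Q * A) (d + n) = coef Q d" "\<And>k. k > d + n \<Longrightarrow> coef (Q * A) k = 0"
    using coef_mult_top[of d Q n A, OF d(2) A(2)] A(1) by auto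
  have "d = m"
  proof (cases d m rule: linorder_cases)
    case less
    then have "coef (Q * A) (m + n) = 0" by (intro top(2)) simp
    then show ?thesis using assms(2) by (simp add: monic_deg_def)
  next
    case greater
    then have "coef (Q * A) (d + n) = 0" using assms(2) by (simp add: monic_deg_def)
    then show ?thesis using top(1) d(1) by simp
  qed
  then show ?thesis using top assms(2) d by (simp add: monic_deg_def)
qed

section \<open>Real polynomials are central\<close>

lemma of_real_commute: "of_real r * x = x * of_real r" for x :: "'a::real_algebra_1"
  by (metis mult.right_neutral mult_scaleR_right of_real_def mult_1 mult_scaleR_left)

lemma coef_of_real_poly [simp]: "coef (of_real_poly p) k = of_real (Polynomial.coeff p k)"
  by transfer simp

lemma of_real_poly_0 [simp]: "of_real_poly 0 = 0"
  and of_real_poly_add: "of_real_poly (p + q) = of_real_poly p + of_real_poly q"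
  and of_real_poly_smult: "of_real_poly (smult c p) = Const (of_real c) * of_real_poly p"
  by (auto intro!: poly_mapping_eqI simp: lookup_add lookup_minus)

lemma of_real_poly_pCons:
  "of_real_poly (pCons c p) = Const (of_real c) + Indet * of_real_poly p"
proof (rule poly_mapping_eqI)
  fix k
  show "coef (of_real_poly (pCons c p)) k = coef (Const (of_real c) + Indet * of_real_poly p :: 'a ncpoly) k"
    by (cases k) (simp_all add: lookup_add coef_Const coeff_pCons)
qed

lemma of_real_poly_1 [simp]: "of_real_poly 1 = 1"
  by (simp add: one_pCons of_real_poly_pCons)

lemma of_real_poly_mult: "of_real_poly (p * q) = of_real_poly p * of_real_poly q"
  by (induction p)
    (simp_all add: of_real_poly_pCons of_real_poly_add of_real_poly_smult algebra_simps)

lemma of_real_poly_commute: "of_real_poly p * W = W * of_real_poly p"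
  for W :: "'a::real_algebra_1 ncpoly"
proof (induction p)
  case (pCons c p)
  have "Const (of_real c) * W = W * Const (of_real c)"
    by (rule poly_mapping_eqI) (simp add: of_real_commute)
  moreover have "Indet * of_real_poly p * W = W * (Indet * of_real_poly p)"
    by (metis pCons.IH mult.assoc Indet_commute)
  ultimately show ?case by (simp add: of_real_poly_pCons algebra_simps)
qed simp

lemma of_real_poly_inject [simp]: "(of_real_poly p :: 'a::real_algebra_1 ncpoly) = of_real_poly q \<longleftrightarrow> p = q"
  by (metis coef_of_real_poly of_real_eq_iff poly_eqI)

lemma monic_deg_of_real_poly: "lead_coeff p = 1 \<Longrightarrow> monic_deg (degree p) (of_real_poly p)"
  by (auto simp: monic_deg_def coeff_eq_0)

lemma degree_less_2_poly:
  assumes "degree p < 2"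
  shows "p = [:coeff p 0, coeff p 1:]"
proof (rule poly_eqI)
  fix k
  show "coeff p k = coeff [:coeff p 0, coeff p 1:] k"
  proof (cases "k < 2")
    case True
    then show ?thesis by (auto simp: less_2_cases_iff)
  next
    case False
    then obtain j where "k = Suc (Suc j)" by (metis add_2_eq_Suc le_Suc_ex not_less)
    then show ?thesis using assms by (simp add: coeff_eq_0)
  qed
qed

text \<open>
  It suffices to divide the powers of \<open>t\<close>, and for these the division takes place over the reals.
\<close>

lemma division_by_quadratic:
  fixes P :: "'a::real_algebra_1 ncpoly"
  assumes "degree M = 2"
  shows "\<exists>T a b. P = T * of_real_poly M + Const a * Indet + Const b"
proof (induction P rule: ncpoly_induct)
  case zero
  show ?case by (intro exI[of _ 0]) simp
next
  case (add P Q)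
  then obtain T a b T' a' b' where
    "P = T * of_real_poly M + Const a * Indet + Const b"
    "Q = T' * of_real_poly M + Const a' * Indet + Const b'" by blast
  then have "P + Q = (T + T') * of_real_poly M + Const (a + a') * Indet + Const (b + b')"
    by (simp add: Const_add algebra_simps)
  then show ?case by blast
next
  case (single k c)
  let ?q = "monom (1::real) k div M" and ?r = "monom (1::real) k mod M"
  have "M \<noteq> 0" using assms by auto
  then have "degree ?r < 2" using degree_mod_less[of M "monom 1 k"] assms by auto
  then obtain a b where r: "?r = [:b, a:]"
    by (rule that[OF degree_less_2_poly])
  have mon: "Poly_Mapping.single k c = Const c * of_real_poly (monom 1 k)"
    by (rule poly_mapping_eqI) (auto simp: lookup_single when_def)
  have "(of_real_poly (monom 1 k) :: 'a ncpoly) = of_real_poly ?q * of_real_poly M + of_real_poly ?r"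
    by (simp only: of_real_poly_mult[symmetric] of_real_poly_add[symmetric] div_mult_mod_eq)
  also have "of_real_poly ?r = Const (of_real b) + Indet * Const (of_real a)"
    by (simp only: r of_real_poly_pCons of_real_poly_0 mult_zero_right add_0_right)
  also have "Indet * Const (of_real a) = Const (of_real a) * Indet"
    by (rule Indet_commute[symmetric])
  finally have "Poly_Mapping.single k c = (Const c * of_real_poly ?q) * of_real_poly M
      + Const (c * of_real a) * Indet + Const (c * of_real b)"
    unfolding mon by (simp only: distrib_left Const_mult mult.assoc add_ac)
  then show ?case
    by (intro exI[of _ "Const c * of_real_poly ?q"] exI[of _ "c * of_real a"] exI[of _ "c * of_real b"])
qed

section \<open>Dual quaternions\<close>

lemma quat_eq_iff: "x = y \<longleftrightarrow> q0 x = q0 y \<and> q1 x = q1 y \<and> q2 x = q2 y \<and> q3 x = q3 y"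
  by (cases x; cases y) auto

lemma dual_eq_iff: "x = y \<longleftrightarrow> primal x = primal y \<and> dual_part x = dual_part y"
  by (cases x; cases y) auto

lemma dual_sel [simp]:
  "primal 0 = 0" "dual_part 0 = 0" "primal 1 = 1" "dual_part 1 = 0"
  "primal (x + y) = primal x + primal y" "dual_part (x + y) = dual_part x + dual_part y"
  "primal (x - y) = primal x - primal y" "dual_part (x - y) = dual_part x - dual_part y"
  "primal (- x) = - primal x" "dual_part (- x) = - dual_part x"
  "primal (x * y) = primal x * primal y"
  "dual_part (x * y) = primal x * dual_part y + dual_part x * primal y"
  "primal (r *\<^sub>R x) = r * primal x" "dual_part (r *\<^sub>R x) = r * dual_part x"
  by (simp_all add: zero_dual_def one_dual_def plus_dual_def minus_dual_def uminus_dual_def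
      times_dual_def scaleR_dual_def)

lemma quat_sel [simp]:
  "q0 0 = 0" "q1 0 = 0" "q2 0 = 0" "q3 0 = 0"
  "q0 1 = 1" "q1 1 = 0" "q2 1 = 0" "q3 1 = 0"
  "q0 (x + y) = q0 x + q0 y" "q1 (x + y) = q1 x + q1 y"
  "q2 (x + y) = q2 x + q2 y" "q3 (x + y) = q3 x + q3 y"
  "q0 (x - y) = q0 x - q0 y" "q1 (x - y) = q1 x - q1 y"
  "q2 (x - y) = q2 x - q2 y" "q3 (x - y) = q3 x - q3 y"
  "q0 (- x) = - q0 x" "q1 (- x) = - q1 x" "q2 (- x) = - q2 x" "q3 (- x) = - q3 x"
  "q0 (x * y) = q0 x * q0 y - q1 x * q1 y - q2 x * q2 y - q3 x * q3 y"
  "q1 (x * y) = q0 x * q1 y + q1 x * q0 y + q2 x * q3 y - q3 x * q2 y"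
  "q2 (x * y) = q0 x * q2 y - q1 x * q3 y + q2 x * q0 y + q3 x * q1 y"
  "q3 (x * y) = q0 x * q3 y + q1 x * q2 y - q2 x * q1 y + q3 x * q0 y"
  by (simp_all add: zero_quat_def one_quat_def plus_quat_def minus_quat_def uminus_quat_def
      times_quat_def)

lemma quat_scaleR_sel [simp]:
  "q0 (r *\<^sub>R x) = r *\<^sub>R q0 x" "q1 (r *\<^sub>R x) = r *\<^sub>R q1 x"
  "q2 (r *\<^sub>R x) = r *\<^sub>R q2 x" "q3 (r *\<^sub>R x) = r *\<^sub>R q3 x"
  by (simp_all add: scaleR_quat_def)

lemma qconj_sel [simp]:
  "q0 (qconj h) = q0 h" "q1 (qconj h) = - q1 h" "q2 (qconj h) = - q2 h" "q3 (qconj h) = - q3 h"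
  by (simp_all add: qconj_def)

lemma qconj_0 [simp]: "qconj 0 = 0"
  and qconj_1 [simp]: "qconj 1 = 1"
  and qconj_add: "qconj (x + y) = qconj x + qconj y"
  and qconj_minus: "qconj (- x) = - qconj x"
  and qconj_diff: "qconj (x - y) = qconj x - qconj y"
  and qconj_mult: "qconj (x * y) = qconj y * qconj x"
  and qconj_commute: "qconj x * x = x * qconj x"
  by (simp_all add: quat_eq_iff algebra_simps)

lemma qconj_of_real [simp]: "qconj (of_real r :: dquat) = of_real r"
  by (simp add: quat_eq_iff of_real_def)

text \<open>The dual unit \<open>\<epsilon>\<close>, as a dual quaternion.\<close>

definition eps :: dquat where
  "eps = Quat (Dual 0 1) 0 0 0"

lemma eps_sel [simp]: "q0 eps = Dual 0 1" "q1 eps = 0" "q2 eps = 0" "q3 eps = 0"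
  by (simp_all add: eps_def)

lemma eps_nonzero: "eps \<noteq> 0"
  by (simp add: quat_eq_iff dual_eq_iff)

lemma eps_eps [simp]: "eps * eps = 0"
  by (simp add: quat_eq_iff dual_eq_iff)

lemma eps_commute: "eps * x = x * eps"
  by (simp add: quat_eq_iff dual_eq_iff)

lemma qconj_eps [simp]: "qconj eps = eps"
  by (simp add: quat_eq_iff)

lemma Const_eps_commute: "Const eps * W = W * Const eps"
  by (rule poly_mapping_eqI) (simp add: eps_commute)

text \<open>
  Multiplication by \<open>\<epsilon>\<close> detects the primal part: below, \<open>eps * x = 0\<close> expresses that the primal
  part of \<open>x\<close> vanishes.
\<close>

lemma eps_mult_eq_0_iff:
  "eps * x = 0 \<longleftrightarrow> primal (q0 x) = 0 \<and> primal (q1 x) = 0 \<and> primal (q2 x) = 0 \<and> primal (q3 x) = 0"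
  by (simp add: quat_eq_iff dual_eq_iff)

lemma of_real_dquat_sel [simp]:
  "q0 (of_real r :: dquat) = Dual r 0" "q1 (of_real r :: dquat) = 0"
  "q2 (of_real r :: dquat) = 0" "q3 (of_real r :: dquat) = 0"
  by (simp_all add: of_real_def dual_eq_iff)

lemma sum_four_squares_eq_0_iff:
  "a * a + b * b + c * c + d * d = 0 \<longleftrightarrow> a = 0 \<and> b = 0 \<and> c = 0 \<and> d = 0" for a b c d :: real
  by (smt (verit) mult_eq_0_iff zero_le_square)

text \<open>The norm form of the real quaternions is anisotropic.\<close>

lemma eps_mult_norm_eq_0:
  assumes "eps * (x * qconj x) = 0"
  shows "eps * x = 0"
  using assms sum_four_squares_eq_0_iff[of "primal (q0 x)" "primal (q1 x)" "primal (q2 x)" "primal (q3 x)"]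
  by (simp add: eps_mult_eq_0_iff)

text \<open>
  The norm of a dual quaternion with nonzero primal part is a dual number with positive primal
  part, hence central and invertible.
\<close>

lemma dquat_invertible:
  assumes "eps * x \<noteq> 0"
  obtains y where "x * y = 1" "y * x = 1"
proof -
  define N where "N = q0 (x * qconj x)"
  have N: "primal N \<noteq> 0"
    using assms sum_four_squares_eq_0_iff[of "primal (q0 x)" "primal (q1 x)" "primal (q2 x)" "primal (q3 x)"]
    by (simp add: eps_mult_eq_0_iff N_def)
  \<comment> \<open>\<open>(r + \<epsilon> s)\<^sup>-\<^sup>1 = r\<^sup>-\<^sup>1 - \<epsilon> s r\<^sup>-\<^sup>2\<close>\<close>
  define I where "I = Dual (1 / primal N) (- dual_part N / (primal N)\<^sup>2)"
  have I: "N * I = 1"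
    using N by (simp add: dual_eq_iff I_def field_simps power2_eq_square)
  define c where "c = Quat I 0 0 0"
  have NI: "x * qconj x * c = 1"
    using I by (simp add: quat_eq_iff c_def N_def algebra_simps)
  have c: "c * z = z * c" for z
    by (simp add: quat_eq_iff c_def algebra_simps)
  show thesis
  proof (rule that)
    show "x * (qconj x * c) = 1" using NI by (simp add: mult.assoc)
    show "qconj x * c * x = 1" by (metis NI c mult.assoc qconj_commute)
  qed
qed

section \<open>Conjugation of polynomials\<close>

lemma coef_nc_conj [simp]: "coef (nc_conj P) k = qconj (coef P k)"
  unfolding nc_conj_def by transfer (simp add: when_def)

lemma nc_conj_add: "nc_conj (P + Q) = nc_conj P + nc_conj Q"
  by (rule poly_mapping_eqI) (simp add: lookup_add qconj_add)

lemma nc_conj_diff: "nc_conj (P - Q) = nc_conj P - nc_conj Q"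
  by (rule poly_mapping_eqI) (simp add: lookup_minus qconj_diff)

lemma nc_conj_Const [simp]: "nc_conj (Const c) = Const (qconj c)"
  by (rule poly_mapping_eqI) (simp add: coef_Const)

lemma nc_conj_Indet [simp]: "nc_conj Indet = Indet"
  by (rule poly_mapping_eqI) (simp add: coef_Indet)

lemma nc_conj_1 [simp]: "nc_conj 1 = 1"
  by (metis Const_1 nc_conj_Const qconj_1)

lemma nc_conj_of_real_poly [simp]: "nc_conj (of_real_poly p :: dquat ncpoly) = of_real_poly p"
  by (rule poly_mapping_eqI) simp

lemma qconj_sum: "qconj (sum f A) = (\<Sum>i\<in>A. qconj (f i))"
  by (induction A rule: infinite_finite_induct) (simp_all add: qconj_add)

lemma nc_conj_mult: "nc_conj (P * Q) = nc_conj Q * nc_conj P"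
proof (rule poly_mapping_eqI)
  fix k
  have "coef (nc_conj (P * Q)) k = (\<Sum>i\<le>k. qconj (coef Q (k - i)) * qconj (coef P i))"
    by (simp add: coef_mult qconj_sum qconj_mult)
  also have "\<dots> = (\<Sum>i\<le>k. qconj (coef Q i) * qconj (coef P (k - i)))"
    by (rule sum.reindex_bij_witness[of _ "\<lambda>i. k - i" "\<lambda>i. k - i"]) auto
  finally show "coef (nc_conj (P * Q)) k = coef (nc_conj Q * nc_conj P) k"
    by (simp add: coef_mult)
qed

section \<open>Linear polynomials and their norms\<close>

text \<open>The linear polynomial \<open>t - h\<close>.\<close>

abbreviation lin :: "'a::ring_1 \<Rightarrow> 'a ncpoly" where
  "lin h \<equiv> Indet - Const h"

lemma linear_mult_linear:
  "lin x * lin y = Indet * Indet - Const (x + y) * Indet + Const (x * y)"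
  for x y :: "'a::ring_1"
  using Indet_commute[of "Const y"] by (simp add: Const_add Const_mult algebra_simps)

lemma linear_norm_commute:
  "lin (qconj h) * lin h = lin h * lin (qconj h)"
  by (simp add: linear_mult_linear qconj_commute add.commute)

lemma nc_conj_linear: "nc_conj (lin h) = lin (qconj h)"
  by (simp add: nc_conj_diff)

lemma of_real_poly_quadratic:
  "(of_real_poly [:m0, m1, 1:] :: 'a::real_algebra_1 ncpoly) = Indet * Indet + Const (of_real m1) * Indet + Const (of_real m0)"
  using Indet_commute[of "Const (of_real m1 :: 'a)"]
  by (simp add: of_real_poly_pCons algebra_simps)

lemma monic_quadratic_cases:
  fixes M :: "real poly"
  assumes "degree M = 2" "lead_coeff M = 1"
  obtains m0 m1 where "M = [:m0, m1, 1:]"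
proof (rule that)
  show "M = [:coeff M 0, coeff M 1, 1:]"
    using assms by (intro poly_eqI)
      (auto simp: coeff_pCons coeff_eq_0 numeral_2_eq_2 split: nat.splits)
qed

text \<open>\<open>h\<close> is a root of the real polynomial \<open>m\<close>.\<close>

abbreviation root_of :: "real poly \<Rightarrow> 'a::real_algebra_1 \<Rightarrow> bool" where
  "root_of m h \<equiv> nc_eval (of_real_poly m) h = 0"

lemma nc_eval_of_real_quadratic:
  fixes h :: "'a::real_algebra_1"
  shows "nc_eval (of_real_poly [:m0, m1, 1:]) h = h * h + of_real m1 * h + of_real m0"
proof -
  let ?M = "of_real_poly [:m0, m1, 1:] :: 'a ncpoly"
  have "nc_eval ?M h = (\<Sum>i\<in>{0,1,2}. coef ?M i * h ^ i)"
    unfolding nc_eval_def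
    by (rule sum.mono_neutral_left) (auto simp: in_keys_iff coeff_pCons split: nat.splits)
  then show ?thesis by (simp add: numeral_2_eq_2 algebra_simps)
qed

lemma root_imp_right_factor:
  fixes h :: "'a::real_algebra_1"
  assumes "degree M = 2" "lead_coeff M = 1" "root_of M h"
  shows "\<exists>W. of_real_poly M = W * lin h"
proof -
  obtain m0 m1 where M: "M = [:m0, m1, 1:]" using assms by (elim monic_quadratic_cases)
  define x where "x = - of_real m1 - h"
  have "x * h - of_real m0 = - (h * h + of_real m1 * h + of_real m0)"
    by (simp add: x_def algebra_simps)
  then have "x * h = of_real m0"
    using assms(3) unfolding M nc_eval_of_real_quadratic by simp
  moreover have "x + h = - of_real m1" by (simp add: x_def)
  ultimately have "of_real_poly M = lin x * lin h"
    unfolding M of_real_poly_quadratic linear_mult_linear by (simp add: Const_minus)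
  then show ?thesis ..
qed

lemma norm_imp_root:
  fixes h :: dquat
  assumes "degree M = 2" "lead_coeff M = 1"
    and "lin h * lin (qconj h) = of_real_poly M"
  shows "root_of M h"
proof -
  obtain m0 m1 where M: "M = [:m0, m1, 1:]" using assms by (elim monic_quadratic_cases)
  have eq: "Indet * Indet - Const (h + qconj h) * Indet + Const (h * qconj h)
     = Indet * Indet + Const (of_real m1) * Indet + Const (of_real m0)"
    using assms(3) unfolding M linear_mult_linear of_real_poly_quadratic .
  have m1: "of_real m1 = - (h + qconj h)" and m0: "of_real m0 = h * qconj h"
    using arg_cong[OF eq, of "\<lambda>P. coef P 1"] arg_cong[OF eq, of "\<lambda>P. coef P 0"]
    by (simp_all add: lookup_add lookup_minus coef_Const coef_Indet)
  show ?thesis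
    unfolding M nc_eval_of_real_quadratic m0 m1 by (simp add: algebra_simps qconj_commute)
qed

section \<open>Irreducible real quadratics\<close>

text \<open>Monic irreducible real polynomials of degree two.\<close>

definition irr_quadratic :: "real poly \<Rightarrow> bool" where
  "irr_quadratic m \<longleftrightarrow> lead_coeff m = 1 \<and> degree m = 2 \<and> irreducible m"

lemma monic_dvd_same_degree:
  fixes p q :: "'a::field poly"
  assumes "p dvd q" "degree p = degree q" "lead_coeff p = 1" "lead_coeff q = 1"
  shows "p = q"
proof -
  obtain r where r: "q = p * r" using assms(1) by blast
  have "p \<noteq> 0" "r \<noteq> 0" using assms r by auto
  then have "degree r = 0" using assms(2) r by (simp add: degree_mult_eq)
  then obtain c where c: "r = [:c:]" by (rule degree_eq_zeroE)
  have "c = 1" using assms r c by (simp add: lead_coeff_mult)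
  then show ?thesis using r c by simp
qed

lemma irr_quadratic_prime_elem: "irr_quadratic m \<Longrightarrow> prime_elem m"
  by (simp add: irr_quadratic_def field_poly_irreducible_imp_prime)

lemma irr_quadratic_coprime:
  assumes "irr_quadratic m" "irr_quadratic m'" "m \<noteq> m'"
  shows "coprime m m'"
proof (rule prime_elem_imp_coprime)
  show "prime_elem m" using assms(1) by (rule irr_quadratic_prime_elem)
  show "\<not> m dvd m'"
    using assms monic_dvd_same_degree[of m m'] by (auto simp: irr_quadratic_def)
qed

lemma coprime_bezout:
  fixes p q :: "real poly"
  assumes "coprime p q"
  obtains u v where "u * p + v * q = 1"
  using assms bezout_coefficients_fst_snd[of p q] by (auto simp: coprime_iff_gcd_eq_1)

text \<open>
  If \<open>t - h\<close> were a right factor of two coprime real polynomials, it would be one of \<open>1\<close>, by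
  Bezout's identity.
\<close>

lemma irr_quadratic_no_common_root:
  fixes h :: "'a::real_algebra_1"
  assumes "irr_quadratic m" "irr_quadratic m'"
    and "root_of m h" "root_of m' h"
  shows "m = m'"
proof (rule ccontr)
  assume "m \<noteq> m'"
  then obtain u v where uv: "u * m + v * m' = 1"
    using assms irr_quadratic_coprime coprime_bezout by metis
  obtain W W' where W: "of_real_poly m = W * lin h" "of_real_poly m' = W' * lin h"
    using assms root_imp_right_factor unfolding irr_quadratic_def by metis
  have "1 = of_real_poly u * of_real_poly m + of_real_poly v * (of_real_poly m' :: 'a ncpoly)"
    by (simp only: of_real_poly_mult[symmetric] of_real_poly_add[symmetric] uv of_real_poly_1)
  also have "\<dots> = (of_real_poly u * W + of_real_poly v * W') * lin h"
    by (simp only: W distrib_right mult.assoc)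
  finally have one: "(of_real_poly u * W + of_real_poly v * W') * lin h = 1" ..
  have "of_real_poly u * W + of_real_poly v * W' = 0"
    by (rule mult_monic_eq_0[OF monic_deg_linear[of h]]) (simp add: one lookup_one)
  then show False using one by simp
qed

section \<open>Splitting off one linear factor\<close>

text \<open>
  For a remainder \<open>R = a t + b\<close> with \<open>m\<close> dividing \<open>R \<cdot> conj R\<close>, the quotient is the constant
  \<open>a \<cdot> conj a\<close>; the conclusions compare the coefficients of \<open>t\<close> and \<open>1\<close>.
\<close>

lemma remainder_norm:
  fixes a b :: dquat and S :: "dquat ncpoly"
  assumes "(Const a * Indet + Const b) * (Const (qconj a) * Indet + Const (qconj b))
      = S * of_real_poly [:m0, m1, 1:]"
  shows "a * qconj b + b * qconj a = a * qconj a * of_real m1"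
    and "b * qconj b = a * qconj a * of_real m0"
proof -
  let ?M = "of_real_poly [:m0, m1, 1:] :: dquat ncpoly"
  define A where "A = a * qconj a"
  have IC: "Indet * Const x = Const x * Indet" for x :: dquat by (rule Indet_commute[symmetric])
  have IC2: "Indet * (Const x * Y) = Const x * (Indet * Y)" for x :: dquat and Y
    by (simp add: IC flip: mult.assoc)
  have "(Const a * Indet + Const b) * (Const (qconj a) * Indet + Const (qconj b))
      = Const A * (Indet * Indet) + Const (a * qconj b + b * qconj a) * Indet + Const (b * qconj b)"
    by (simp add: A_def Const_mult Const_add algebra_simps IC IC2)
  moreover have "Const A * ?M = Const A * (Indet * Indet) + Const (A * of_real m1) * Indet + Const (A * of_real m0)"
    unfolding of_real_poly_quadratic by (simp add: Const_mult algebra_simps)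
  ultimately have eq: "(S - Const A) * ?M = Const (a * qconj b + b * qconj a - A * of_real m1) * Indet
      + Const (b * qconj b - A * of_real m0)"
    using assms by (simp add: Const_diff left_diff_distrib)
  have "monic_deg 2 ?M" using monic_deg_of_real_poly[of "[:m0, m1, 1:]"] by (simp add: numeral_2_eq_2)
  then have "S - Const A = 0"
    by (rule mult_monic_eq_0) (simp add: eq lookup_add coef_Const coef_Indet)
  then have z: "Const (a * qconj b + b * qconj a - A * of_real m1) * Indet
      + Const (b * qconj b - A * of_real m0) = 0" using eq by simp
  show "a * qconj b + b * qconj a = a * qconj a * of_real m1"
    using arg_cong[OF z, of "\<lambda>P. coef P 1"] by (simp add: lookup_add coef_Const coef_Indet A_def)
  show "b * qconj b = a * qconj a * of_real m0"
    using arg_cong[OF z, of "\<lambda>P. coef P 0"] by (simp add: lookup_add coef_Const coef_Indet A_def)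
qed

text \<open>
  The primal part of \<open>P\<close> is not divisible by \<open>m\<close>: otherwise \<open>\<epsilon> N m\<close> would be divisible by \<open>m\<^sup>2\<close>,
  hence \<open>\<epsilon> N\<close> by \<open>m\<close>, and with Bezout's identity \<open>\<epsilon>\<close> itself would be divisible by \<open>m\<close>.
\<close>

lemma not_primal_divisible:
  fixes P T :: "dquat ncpoly"
  assumes m: "lead_coeff m = 1" "degree m = 2" and cop: "coprime m N"
    and P: "P * nc_conj P = of_real_poly (N * m)"
  shows "Const eps * P \<noteq> Const eps * T * of_real_poly m"
proof
  let ?E = "Const eps" and ?m = "of_real_poly m :: dquat ncpoly"
  note E = Const_eps_commute
  have mon: "monic_deg 2 ?m" using monic_deg_of_real_poly[OF m(1)] m(2) by simp
  assume eq: "?E * P = ?E * T * ?m"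
  have eq': "nc_conj P * ?E = ?m * (nc_conj T * ?E)"
    using arg_cong[OF eq, of nc_conj] by (simp add: nc_conj_mult)
  have "(?E * of_real_poly N) * ?m = ?E * P * nc_conj P"
    by (simp add: P of_real_poly_mult mult.assoc)
  also have "\<dots> = ?E * (T * ?m * nc_conj P)"
    by (simp only: eq mult.assoc)
  also have "\<dots> = T * (?m * (?m * (nc_conj T * ?E)))"
    unfolding E[of "T * ?m * nc_conj P"] by (simp only: mult.assoc eq')
  also have "\<dots> = (T * nc_conj T * ?E * ?m) * ?m"
    by (simp only: of_real_poly_commute[of m "nc_conj T * ?E"]
        of_real_poly_commute[of m "nc_conj T * (?E * ?m)"] mult.assoc)
  finally have EN: "?E * of_real_poly N = T * nc_conj T * ?E * ?m"
    by (rule monic_right_cancel[OF mon])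
  obtain u v where uv: "u * m + v * N = 1" using cop by (rule coprime_bezout)
  have "?E = of_real_poly (u * m + v * N) * ?E" by (simp add: uv)
  also have "\<dots> = of_real_poly u * ?E * ?m + of_real_poly v * (?E * of_real_poly N)"
    by (simp only: of_real_poly_add of_real_poly_mult distrib_right mult.assoc
        of_real_poly_commute[of m ?E] of_real_poly_commute[of N ?E])
  also have "\<dots> = (of_real_poly u * ?E + of_real_poly v * (T * nc_conj T * ?E)) * ?m"
    unfolding EN by (simp add: distrib_right mult.assoc)
  finally have D: "(of_real_poly u * ?E + of_real_poly v * (T * nc_conj T * ?E)) * ?m = ?E" ..
  have "of_real_poly u * ?E + of_real_poly v * (T * nc_conj T * ?E) = 0"
    by (rule mult_monic_eq_0[OF mon]) (simp add: D coef_Const)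
  then have "?E = 0" using D by simp
  then show False by (simp add: eps_nonzero)
qed

text \<open>
  The right factor of \<open>P\<close> singled out by a simple real quadratic factor of its norm polynomial;
  simplicity is the coprimality of \<open>m\<close> and \<open>N\<close>.
\<close>

lemma linear_right_factor:
  fixes P :: "dquat ncpoly"
  assumes m: "lead_coeff m = 1" "degree m = 2" and cop: "coprime m N"
    and P: "P * nc_conj P = of_real_poly (N * m)"
  obtains Q h where "P = Q * lin h" "lin h * lin (qconj h) = of_real_poly m"
    "\<And>Q' h'. P = Q' * lin h' \<Longrightarrow> root_of m h' \<Longrightarrow> h' = h"
proof -
  let ?m = "of_real_poly m :: dquat ncpoly" and ?E = "Const eps"
  obtain m0 m1 where m01: "m = [:m0, m1, 1:]" using m by (elim monic_quadratic_cases)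
  obtain T a b where T: "P = T * ?m + Const a * Indet + Const b"
    using division_by_quadratic[OF m(2)] by blast
  define R where "R = Const a * Indet + Const b"
  have PR: "P = T * ?m + R" using T by (simp add: R_def add.assoc)
  have cR: "nc_conj R = Const (qconj a) * Indet + Const (qconj b)"
    by (simp add: R_def nc_conj_add nc_conj_mult Indet_commute[symmetric])
  have cP: "nc_conj P = nc_conj T * ?m + nc_conj R"
    by (simp add: PR nc_conj_add nc_conj_mult of_real_poly_commute)
  have "P * nc_conj P = (T * ?m * nc_conj T + T * nc_conj R + R * nc_conj T) * ?m + R * nc_conj R"
    unfolding cP unfolding PR
    by (simp add: algebra_simps of_real_poly_commute[of m "nc_conj R"])
  then have "R * nc_conj R
      = (of_real_poly N - (T * ?m * nc_conj T + T * nc_conj R + R * nc_conj T)) * ?m"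
    by (simp add: P of_real_poly_mult left_diff_distrib)
  then have ab: "a * qconj b + b * qconj a = a * qconj a * of_real m1"
    "b * qconj b = a * qconj a * of_real m0"
    unfolding cR unfolding R_def m01 by (rule remainder_norm)+

  \<comment> \<open>\<open>a\<close> has nonzero primal part: otherwise the primal part of \<open>b\<close>, whose norm is a multiple of
    that of \<open>a\<close>, vanishes too, and \<open>m\<close> divides the primal part of \<open>P\<close>\<close>
  have "eps * a \<noteq> 0"
  proof
    assume a: "eps * a = 0"
    have "eps * (b * qconj b) = eps * a * qconj a * of_real m0" by (simp add: ab mult.assoc)
    also have "\<dots> = 0" by (simp add: a)
    finally have b: "eps * b = 0" by (rule eps_mult_norm_eq_0)
    have "?E * R = 0"
      using a b by (simp add: R_def distrib_left flip: Const_mult mult.assoc)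
    then have "?E * P = ?E * T * ?m" by (simp add: PR distrib_left mult.assoc)
    then show False using not_primal_divisible[OF m cop P] by blast
  qed
  then obtain y where y: "a * y = 1" "y * a = 1" by (rule dquat_invertible)
  have cy: "qconj a * qconj y = 1" using y(2) by (metis qconj_1 qconj_mult)
  \<comment> \<open>the root of the remainder, as \<open>y\<close> is the inverse of \<open>a\<close>\<close>
  define h where "h = - (y * b)"
  have "h + qconj h = - (y * (a * qconj b + b * qconj a) * qconj y)"
  proof -
    have "y * (a * qconj b + b * qconj a) * qconj y
        = (y * a) * (qconj b * qconj y) + y * b * (qconj a * qconj y)"
      by (simp only: distrib_left distrib_right mult.assoc)
    then show ?thesis by (simp add: y cy h_def qconj_minus qconj_mult)
  qed
  also have "\<dots> = - ((y * a) * (qconj a * qconj y) * of_real m1)"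
    unfolding ab by (simp add: mult.assoc of_real_commute)
  finally have tr: "h + qconj h = - of_real m1" using y cy by simp
  have "h * qconj h = y * (b * qconj b) * qconj y"
    by (simp add: h_def qconj_minus qconj_mult mult.assoc)
  also have "\<dots> = (y * a) * (qconj a * qconj y) * of_real m0"
    unfolding ab by (simp add: mult.assoc of_real_commute)
  finally have nm: "h * qconj h = of_real m0" using y cy by simp
  have norm: "lin h * lin (qconj h) = ?m"
    unfolding linear_mult_linear tr nm m01 of_real_poly_quadratic by (simp add: Const_minus)
  have R: "R = Const a * lin h"
    by (simp add: R_def h_def distrib_left Const_minus y flip: Const_mult mult.assoc)
  have PQ: "P = (T * lin (qconj h) + Const a) * lin h"
    by (simp add: PR R distrib_right mult.assoc linear_norm_commute norm)
  show thesis
  proof (rule that[OF PQ norm])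
    fix Q' h'
    assume P': "P = Q' * lin h'" and root: "root_of m h'"
    \<comment> \<open>\<open>t - h'\<close> is a right factor of \<open>P\<close> and \<open>m\<close>, hence of \<open>R = a (t - h)\<close> and of the constant
      \<open>R - a (t - h')\<close>, which therefore vanishes\<close>
    obtain W where W: "?m = W * lin h'" using root_imp_right_factor[OF m(2,1) root] by blast
    have "(Q' - T * W - Const a) * lin h' = P - T * ?m - Const a * lin h'"
      unfolding W by (simp add: P' left_diff_distrib mult.assoc)
    also have "\<dots> = Const a * lin h - Const a * lin h'" by (simp add: PR R)
    also have "\<dots> = Const (a * (h' - h))"
      by (simp add: Const_mult Const_diff algebra_simps)
    finally have eq: "(Q' - T * W - Const a) * lin h' = Const (a * (h' - h))" .
    have "Q' - T * W - Const a = 0"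
      by (rule mult_monic_eq_0[OF monic_deg_linear]) (subst eq, simp add: coef_Const)
    then have "a * (h' - h) = 0" using eq by simp
    then have "y * a * (h' - h) = 0" by (simp add: mult.assoc)
    then show "h' = h" using y by simp
  qed
qed

section \<open>Factorizations with prescribed order of the quadratic factors\<close>

text \<open>The product \<open>(t - h\<^sub>1) \<cdots> (t - h\<^sub>n)\<close>.\<close>

abbreviation lin_prod :: "'a::ring_1 list \<Rightarrow> 'a ncpoly" where
  "lin_prod hs \<equiv> prod_list (map lin hs)"

lemma coprime_prod_list_right:
  "(\<And>x. x \<in> set xs \<Longrightarrow> coprime m x) \<Longrightarrow> coprime m (prod_list xs)"
  for m :: "'a::semiring_gcd"
  by (induction xs) simp_all

lemma monic_deg_0_imp_1:
  assumes "monic_deg 0 P"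
  shows "P = 1"
proof (rule poly_mapping_eqI)
  fix k
  show "coef P k = coef 1 k"
    using assms by (cases k) (auto simp: monic_deg_def lookup_one)
qed

text \<open>The last quadratic in the list determines the rightmost linear factor.\<close>

lemma ex1_ordered_factorization:
  fixes P :: "dquat ncpoly"
  assumes "monic_deg (length ms) P" "P * nc_conj P = of_real_poly (prod_list ms)"
    and "distinct ms" "\<And>m. m \<in> set ms \<Longrightarrow> irr_quadratic m"
  shows "\<exists>!hs. P = lin_prod hs \<and> list_all2 root_of ms hs"
  using assms
proof (induction ms arbitrary: P rule: rev_induct)
  case Nil
  then have "P = 1" using monic_deg_0_imp_1[of P] by simp
  then show ?case by auto
next
  case (snoc m ms)
  let ?m = "of_real_poly m :: dquat ncpoly"
  have m: "lead_coeff m = 1" "degree m = 2" using snoc.prems(4)[of m] by (auto simp: irr_quadratic_def)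
  have "coprime m (prod_list ms)"
  proof (rule coprime_prod_list_right)
    fix x assume "x \<in> set ms"
    then show "coprime m x"
      using snoc.prems(3,4) by (intro irr_quadratic_coprime) auto
  qed
  moreover have PP: "P * nc_conj P = of_real_poly (prod_list ms * m)" using snoc.prems(2) by simp
  ultimately obtain Q h where Q: "P = Q * lin h" and norm: "lin h * lin (qconj h) = ?m"
    and uniq: "\<And>Q' h'. P = Q' * lin h' \<Longrightarrow> root_of m h' \<Longrightarrow> h' = h"
    using linear_right_factor[OF m] by blast
  have root: "root_of m h" using norm_imp_root[OF m(2,1) norm] .
  have "monic_deg (length ms) Q"
    using monic_deg_left_factor[OF monic_deg_linear, of "length ms" Q h] snoc.prems(1) Q by simp
  moreover have "Q * nc_conj Q = of_real_poly (prod_list ms)"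
  proof (rule monic_right_cancel)
    show "monic_deg 2 ?m" using monic_deg_of_real_poly[OF m(1)] m(2) by simp
    have "Q * nc_conj Q * ?m = Q * (lin h * lin (qconj h)) * nc_conj Q"
      unfolding norm mult.assoc of_real_poly_commute[of m "nc_conj Q"] ..
    also have "\<dots> = P * nc_conj P" by (simp only: Q nc_conj_mult nc_conj_linear mult.assoc)
    finally show "Q * nc_conj Q * ?m = of_real_poly (prod_list ms) * ?m"
      by (simp add: PP of_real_poly_mult)
  qed
  ultimately have "\<exists>!hs. Q = lin_prod hs \<and> list_all2 root_of ms hs"
    using snoc.prems(3,4) by (intro snoc.IH) auto
  then obtain hs where hs: "Q = lin_prod hs" "list_all2 root_of ms hs"
    and hs_uniq: "\<And>us. Q = lin_prod us \<Longrightarrow> list_all2 root_of ms us \<Longrightarrow> us = hs" by metis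
  show ?case
  proof (rule ex1I[of _ "hs @ [h]"])
    show "P = lin_prod (hs @ [h]) \<and> list_all2 root_of (ms @ [m]) (hs @ [h])"
      using Q hs root by (simp add: list_all2_appendI)
    fix us assume us: "P = lin_prod us \<and> list_all2 root_of (ms @ [m]) us"
    then obtain vs h' where vs: "us = vs @ [h']" "list_all2 root_of ms vs" "root_of m h'"
      by (auto simp: list_all2_append1 list_all2_Cons1)
    have P': "P = lin_prod vs * lin h'" using us vs by simp
    then have "h' = h" using uniq vs(3) by blast
    moreover have "Q = lin_prod vs"
    proof (rule monic_right_cancel[OF monic_deg_linear])
      show "Q * lin h = lin_prod vs * lin h" using P' Q \<open>h' = h\<close> by simp
    qed
    ultimately show "us = hs @ [h]" using hs_uniq vs by simp
  qed
qed

section \<open>Polynomials with dual number coefficients\<close>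

text \<open>
  The polynomial \<open>p + \<epsilon> q\<close> over the dual numbers, given by its real parts and viewed as a central
  polynomial over the dual quaternions.
\<close>

definition dual_poly :: "real poly \<Rightarrow> real poly \<Rightarrow> dquat ncpoly" where
  "dual_poly p q = of_real_poly p + Const eps * of_real_poly q"

lemma dual_poly_commute: "dual_poly p q * W = W * dual_poly p q"
proof -
  have "Const eps * of_real_poly q * W = W * (Const eps * of_real_poly q)"
    by (metis Const_eps_commute mult.assoc of_real_poly_commute)
  then show ?thesis
    by (simp add: dual_poly_def distrib_left distrib_right of_real_poly_commute[of p])
qed

lemma dual_poly_mult: "dual_poly p q * dual_poly p' q' = dual_poly (p * p') (p * q' + q * p')"
proof -
  let ?E = "Const eps"
  have E: "of_real_poly r * (?E * W) = ?E * (of_real_poly r * W)" for r W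
    by (metis mult.assoc of_real_poly_commute)
  have EE: "?E * (?E * W) = 0" for W by (simp flip: mult.assoc Const_mult)
  show ?thesis
    by (simp add: dual_poly_def of_real_poly_add of_real_poly_mult distrib_left distrib_right
        mult.assoc E EE)
qed

lemma dual_poly_inject: "dual_poly p q = dual_poly p' q' \<longleftrightarrow> p = p' \<and> q = q'"
proof
  assume eq: "dual_poly p q = dual_poly p' q'"
  have "coeff p k = coeff p' k \<and> coeff q k = coeff q' k" for k
    using arg_cong[OF eq, of "\<lambda>P. q0 (coef P k)"]
    by (simp add: dual_poly_def lookup_add dual_eq_iff)
  then show "p = p' \<and> q = q'" by (simp add: poly_eq_iff)
qed simp

lemma linear_norm_dual_poly:
  obtains p q where "lin h * lin (qconj h) = dual_poly p q"
    "lead_coeff p = 1" "degree p = 2" "degree q < 2"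
proof -
  \<comment> \<open>trace and norm of \<open>h\<close> have no vectorial part, hence are dual numbers\<close>
  have scalar: "\<exists>r s. x = of_real r + eps * of_real s" if "q1 x = 0" "q2 x = 0" "q3 x = 0" for x :: dquat
    using that by (intro exI[of _ "primal (q0 x)"] exI[of _ "dual_part (q0 x)"])
      (simp add: quat_eq_iff dual_eq_iff)
  obtain n n' where n: "h * qconj h = of_real n + eps * of_real n'"
    using scalar[of "h * qconj h"] by (auto simp: algebra_simps)
  obtain t t' where t: "h + qconj h = of_real t + eps * of_real t'"
    using scalar[of "h + qconj h"] by auto
  have "lin h * lin (qconj h) = dual_poly [:n, - t, 1:] [:n', - t':]"
    unfolding linear_mult_linear n t dual_poly_def
  proof (rule poly_mapping_eqI)
    fix k
    consider "k = 0" | "k = 1" | j where "k = Suc (Suc j)" by (metis One_nat_def nat.exhaust)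
    then show "coef (Indet * Indet - Const (of_real t + eps * of_real t') * Indet
          + Const (of_real n + eps * of_real n')) k
        = coef (of_real_poly [:n, - t, 1:] + Const eps * of_real_poly [:n', - t':]) k"
      by cases (auto simp: lookup_add lookup_minus coef_Const coef_Indet coeff_pCons split: nat.splits)
  qed
  then show thesis by (rule that) (auto simp: numeral_2_eq_2)
qed

text \<open>
  The norm of the remaining product is central, so it can be moved out from between \<open>t - h\<close> and
  its conjugate.
\<close>

lemma lin_prod_Cons_norm:
  assumes pq: "lin h * lin (qconj h) = dual_poly p q"
    and AB: "lin_prod hs * nc_conj (lin_prod hs) = dual_poly A B"
  shows "lin_prod (h # hs) * nc_conj (lin_prod (h # hs)) = dual_poly (p * A) (p * B + q * A)"
proof -
  have "lin_prod (h # hs) * nc_conj (lin_prod (h # hs))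
      = lin h * (lin_prod hs * nc_conj (lin_prod hs)) * lin (qconj h)"
    by (simp add: nc_conj_mult nc_conj_linear mult.assoc)
  also have "\<dots> = dual_poly p q * dual_poly A B"
    unfolding AB mult.assoc dual_poly_commute[of A B] by (simp only: pq flip: mult.assoc)
  finally show ?thesis by (simp only: dual_poly_mult)
qed

lemma lin_prod_norm_dual_poly: "\<exists>A B. lin_prod hs * nc_conj (lin_prod hs) = dual_poly A B"
proof (induction hs)
  case Nil
  show ?case by (intro exI[of _ 1] exI[of _ 0]) (simp add: dual_poly_def)
next
  case (Cons h hs)
  then obtain A B where AB: "lin_prod hs * nc_conj (lin_prod hs) = dual_poly A B" by blast
  obtain p q where pq: "lin h * lin (qconj h) = dual_poly p q" by (rule linear_norm_dual_poly)
  show ?case using lin_prod_Cons_norm[OF pq AB] by blast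
qed

section \<open>Norms of the linear factors of an arbitrary factorization\<close>

text \<open>
  Irreducibility of \<open>p\<close> need not be assumed: as a nonunit, \<open>p\<close> is divisible by some \<open>m \<in> S\<close>, and
  both are monic of degree two.
\<close>

lemma quadratic_dvd_prod_irr:
  assumes "finite S" "\<And>m. m \<in> S \<Longrightarrow> irr_quadratic m"
    and "lead_coeff p = 1" "degree p = 2" "p dvd \<Prod>S"
  shows "p \<in> S"
proof -
  have "\<exists>m\<in>S. m dvd p" if "\<not> p dvd 1" "p dvd \<Prod>S" for p
    using assms(1,2) that
  proof (induction S arbitrary: p rule: finite_induct)
    case (insert m S)
    obtain r where r: "m * \<Prod>S = p * r" using insert.prems(3) insert.hyps by (auto elim: dvdE)
    have pm: "prime_elem m" using insert.prems(1) by (intro irr_quadratic_prime_elem) simp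
    have "m dvd p * r" unfolding r[symmetric] by simp
    then have "m dvd p \<or> m dvd r" using prime_elem_dvd_mult_iff[OF pm] by simp
    then consider "m dvd p" | s where "r = m * s" by (metis dvdE)
    then show ?case
    proof cases
      case 2
      then have "m * \<Prod>S = m * (p * s)" using r by (simp add: ac_simps)
      then have "\<Prod>S = p * s" using pm by (simp add: prime_elem_def)
      then show ?thesis using insert.IH[of p] insert.prems by auto
    qed auto
  qed simp
  moreover have "p \<noteq> 0" using assms(4) by auto
  then have "\<not> p dvd 1" using assms(4) by (simp add: is_unit_iff_degree)
  ultimately obtain m where "m \<in> S" "m dvd p" using assms(5) by blast
  then show ?thesis
    using assms(2)[of m] assms(3,4) monic_dvd_same_degree[of m p]
    by (metis irr_quadratic_def)
qed

text \<open>
  The quadratics appear in the order of the factors; \<open>list_all2\<close> also makes the lengths agree.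
\<close>

lemma factorization_norms:
  fixes hs :: "dquat list"
  assumes "finite S" "\<And>m. m \<in> S \<Longrightarrow> irr_quadratic m"
    and "lin_prod hs * nc_conj (lin_prod hs) = of_real_poly (\<Prod>S)"
  shows "\<exists>ms. distinct ms \<and> set ms = S \<and> list_all2 root_of ms hs"
  using assms
proof (induction hs arbitrary: S)
  case Nil
  then have "of_real_poly (\<Prod>S) = (of_real_poly 1 :: dquat ncpoly)" by simp
  then have "\<Prod>S = 1" by (simp only: of_real_poly_inject)
  have "m dvd 1" if "m \<in> S" for m
    using dvd_prod_eqI[OF Nil.prems(1) that, of m "\<lambda>x. x"] \<open>\<Prod>S = 1\<close> by simp
  then have "S = {}" using Nil.prems(2) by (auto simp: irr_quadratic_def irreducible_def)
  then show ?case by simp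
next
  case (Cons h hs)
  obtain A B where AB: "lin_prod hs * nc_conj (lin_prod hs) = dual_poly A B"
    using lin_prod_norm_dual_poly by blast
  obtain p q where pq: "lin h * lin (qconj h) = dual_poly p q"
    and p: "lead_coeff p = 1" "degree p = 2" and q: "degree q < 2"
    by (rule linear_norm_dual_poly)
  have "dual_poly (p * A) (p * B + q * A) = dual_poly (\<Prod>S) 0"
    using Cons.prems(3) unfolding lin_prod_Cons_norm[OF pq AB] by (simp add: dual_poly_def)
  then have pA: "p * A = \<Prod>S" and pB: "p * B + q * A = 0" by (simp_all add: dual_poly_inject)
  have pS: "p \<in> S"
    using quadratic_dvd_prod_irr[OF Cons.prems(1,2) p] pA by (metis dvd_triv_left)
  have "p \<noteq> 0" using p by auto
  have S: "\<Prod>S = p * \<Prod>(S - {p})" using prod.remove[OF Cons.prems(1) pS] .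
  then have A: "A = \<Prod>(S - {p})" using pA \<open>p \<noteq> 0\<close> by simp
  have "coprime p A"
    unfolding A using Cons.prems(2) pS by (intro prod_coprime_right irr_quadratic_coprime) auto
  moreover have "p dvd q * A" using pB by (metis dvd_minus_iff dvd_triv_left eq_neg_iff_add_eq_0)
  ultimately have "p dvd q" by (simp add: coprime_dvd_mult_left_iff)
  then have "q = 0" using p q dvd_imp_degree_le[of p q] by force
  then have "B = 0" using pB \<open>p \<noteq> 0\<close> by simp
  have "\<exists>ms. distinct ms \<and> set ms = S - {p} \<and> list_all2 root_of ms hs"
    using Cons.prems(1,2) AB A \<open>B = 0\<close> by (intro Cons.IH) (auto simp: dual_poly_def)
  then obtain ms where "distinct ms" "set ms = S - {p}" "list_all2 root_of ms hs" by blast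
  moreover have "root_of p h"
    using pq \<open>q = 0\<close> by (intro norm_imp_root[OF p(2,1)]) (simp add: dual_poly_def)
  ultimately show ?case using pS by (intro exI[of _ "p # ms"]) auto
qed

section \<open>Orderings of the quadratic factors as permutations\<close>

lemma permutation_of_enumeration:
  assumes "inj_on M {..<n}" "distinct ms" "set ms = M ` {..<n}"
  obtains \<sigma> where "\<sigma> permutes {..<n}" "ms = map (M \<circ> \<sigma>) [0..<n]"
proof -
  have len: "length ms = n"
    using assms by (metis card_image card_lessThan distinct_card)
  define \<sigma> where "\<sigma> i = (if i < n then the_inv_into {..<n} M (ms ! i) else i)" for i
  have "bij_betw ((!) ms) {..<n} (M ` {..<n})"
    using bij_betw_nth[OF assms(2)] len assms(3) by simp
  moreover have "bij_betw (the_inv_into {..<n} M) (M ` {..<n}) {..<n}"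
    using assms(1) by (simp add: bij_betw_imageI bij_betw_the_inv_into)
  ultimately have "bij_betw (the_inv_into {..<n} M \<circ> (!) ms) {..<n} {..<n}"
    by (rule bij_betw_trans)
  then have "bij_betw \<sigma> {..<n} {..<n}"
    by (rule bij_betw_cong[THEN iffD1, rotated]) (simp add: \<sigma>_def)
  then have "\<sigma> permutes {..<n}" by (rule bij_imp_permutes) (simp add: \<sigma>_def)
  moreover have "ms = map (M \<circ> \<sigma>) [0..<n]"
  proof (rule nth_equalityI)
    fix i assume "i < length ms"
    then show "ms ! i = map (M \<circ> \<sigma>) [0..<n] ! i"
      using assms len f_the_inv_into_f[OF assms(1), of "ms ! i"] nth_mem[of i ms]
      by (simp add: \<sigma>_def)
  qed (simp add: len)
  ultimately show thesis by (rule that)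
qed

text \<open>
  Passage from permutations \<open>\<sigma>\<close> to lists of quadratics \<open>[M (\<sigma> 0), \<dots>, M (\<sigma> (n - 1))]\<close>.
\<close>

lemma roots_along_iff:
  "length hs = n \<Longrightarrow> roots_along M \<sigma> hs \<longleftrightarrow> list_all2 root_of (map (M \<circ> \<sigma>) [0..<n]) hs"
  by (auto simp: roots_along_def list_all2_conv_all_nth)

theorem theorem8:
  fixes P :: "dquat ncpoly" and M :: "nat \<Rightarrow> real poly" and n :: nat
  assumes "generic_motion_polynomial P" and "nc_degree P = n" and "n > 0"
    and "quadratic_factors P M"
  shows "(\<exists>\<Phi>. bij_betw \<Phi> {\<sigma>. \<sigma> permutes {..<n}} {hs. linear_factorization P hs} \<and>
            (\<forall>\<sigma>. \<sigma> permutes {..<n} \<longrightarrow> roots_along M \<sigma> (\<Phi> \<sigma>))) \<and>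
         (\<forall>\<sigma>. \<sigma> permutes {..<n} \<longrightarrow>
            (\<exists>!hs. linear_factorization P hs \<and> roots_along M \<sigma> hs)) \<and>
         (\<forall>hs. linear_factorization P hs \<longrightarrow>
            (\<exists>!\<sigma>. \<sigma> permutes {..<n} \<and> roots_along M \<sigma> hs))"
proof -
  have irr: "irr_quadratic (M i)" if "i < n" for i
    using assms(2,4) that unfolding quadratic_factors_def irr_quadratic_def by metis
  have inj: "inj_on M {..<n}" and norm: "P * nc_conj P = of_real_poly (\<Prod>i<n. M i)"
    using assms(2,4) by (simp_all add: quadratic_factors_def)
  have monic: "monic_deg n P"
    using assms(1,2) by (simp add: monic_deg_iff generic_motion_polynomial_def motion_polynomial_def)
  have factorization_iff: "linear_factorization P hs \<longleftrightarrow> length hs = n \<and> P = lin_prod hs" for hs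
    by (simp add: linear_factorization_def assms(2))

  have ex1_hs: "\<exists>!hs. linear_factorization P hs \<and> roots_along M \<sigma> hs"
    if \<sigma>: "\<sigma> permutes {..<n}" for \<sigma>
  proof -
    let ?ms = "map (M \<circ> \<sigma>) [0..<n]"
    have lt: "\<sigma> i < n" if "i < n" for i using permutes_in_image[OF \<sigma>, of i] that by simp
    have "prod_list ?ms = (\<Prod>i<n. M (\<sigma> i))"
      using prod.distinct_set_conv_list[of "[0..<n]" "M \<circ> \<sigma>"] by (simp add: atLeast0LessThan)
    also have "\<dots> = (\<Prod>i<n. M i)" using prod.permute[OF \<sigma>, where g = M] by (simp add: comp_def)
    finally have "P * nc_conj P = of_real_poly (prod_list ?ms)" using norm by simp
    moreover have "distinct ?ms"
      unfolding distinct_map using comp_inj_on[OF permutes_inj_on[OF \<sigma>, of "{..<n}"], of M] inj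
        permutes_image[OF \<sigma>] by (simp add: atLeast0LessThan)
    ultimately have "\<exists>!hs. P = lin_prod hs \<and> list_all2 root_of ?ms hs"
      using monic irr lt by (intro ex1_ordered_factorization) auto
    moreover have "linear_factorization P hs \<and> roots_along M \<sigma> hs
        \<longleftrightarrow> P = lin_prod hs \<and> list_all2 root_of ?ms hs" for hs
      using roots_along_iff[of hs n M \<sigma>] list_all2_lengthD[of root_of ?ms hs]
      by (auto simp: factorization_iff)
    ultimately show ?thesis by presburger
  qed

  have ex1_perm: "\<exists>!\<sigma>. \<sigma> permutes {..<n} \<and> roots_along M \<sigma> hs"
    if hs: "linear_factorization P hs" for hs
  proof (rule ex_ex1I)
    have "(\<Prod>i<n. M i) = \<Prod>(M ` {..<n})" using prod.reindex[OF inj, of "\<lambda>x. x"] by (simp add: comp_def)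
    then have "\<exists>ms. distinct ms \<and> set ms = M ` {..<n} \<and> list_all2 root_of ms hs"
      using hs norm irr by (intro factorization_norms) (auto simp: factorization_iff)
    then obtain ms where ms: "distinct ms" "set ms = M ` {..<n}" "list_all2 root_of ms hs" by blast
    obtain \<sigma> where "\<sigma> permutes {..<n}" "ms = map (M \<circ> \<sigma>) [0..<n]"
      using permutation_of_enumeration[OF inj ms(1,2)] .
    then show "\<exists>\<sigma>. \<sigma> permutes {..<n} \<and> roots_along M \<sigma> hs"
      using ms(3) hs roots_along_iff[of hs n M \<sigma>] by (auto simp: factorization_iff)
  next
    fix \<sigma> \<tau>
    assume \<sigma>: "\<sigma> permutes {..<n} \<and> roots_along M \<sigma> hs"
      and \<tau>: "\<tau> permutes {..<n} \<and> roots_along M \<tau> hs"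
    show "\<sigma> = \<tau>"
    proof
      fix i
      show "\<sigma> i = \<tau> i"
      proof (cases "i < n")
        case True
        then have lt: "\<sigma> i < n" "\<tau> i < n"
          using \<sigma> \<tau> permutes_in_image[of _ "{..<n}" i] by auto
        have "root_of (M (\<sigma> i)) (hs ! i)" "root_of (M (\<tau> i)) (hs ! i)"
          using \<sigma> \<tau> True hs by (auto simp: roots_along_def factorization_iff)
        then have "M (\<sigma> i) = M (\<tau> i)"
          using irr_quadratic_no_common_root irr lt by blast
        then show ?thesis using inj lt by (simp add: inj_on_eq_iff)
      next
        case False
        then show ?thesis using \<sigma> \<tau> by (simp add: permutes_def)
      qed
    qed
  qed

  define \<Phi> where "\<Phi> \<sigma> = (THE hs. linear_factorization P hs \<and> roots_along M \<sigma> hs)" for \<sigma>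
  have \<Phi>: "linear_factorization P (\<Phi> \<sigma>)" "roots_along M \<sigma> (\<Phi> \<sigma>)" if "\<sigma> permutes {..<n}" for \<sigma>
    using theI'[OF ex1_hs[OF that]] unfolding \<Phi>_def by blast+
  have "bij_betw \<Phi> {\<sigma>. \<sigma> permutes {..<n}} {hs. linear_factorization P hs}"
  proof (rule bij_betwI')
    fix \<sigma> \<tau> assume "\<sigma> \<in> {\<sigma>. \<sigma> permutes {..<n}}" "\<tau> \<in> {\<sigma>. \<sigma> permutes {..<n}}"
    then show "\<Phi> \<sigma> = \<Phi> \<tau> \<longleftrightarrow> \<sigma> = \<tau>" using \<Phi> ex1_perm by (metis mem_Collect_eq)
  next
    fix \<sigma> assume "\<sigma> \<in> {\<sigma>. \<sigma> permutes {..<n}}"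
    then show "\<Phi> \<sigma> \<in> {hs. linear_factorization P hs}" using \<Phi> by simp
  next
    fix hs assume "hs \<in> {hs. linear_factorization P hs}"
    then obtain \<sigma> where "\<sigma> permutes {..<n}" "linear_factorization P hs" "roots_along M \<sigma> hs"
      using ex1_perm by blast
    then show "\<exists>\<sigma>\<in>{\<sigma>. \<sigma> permutes {..<n}}. hs = \<Phi> \<sigma>" using \<Phi> ex1_hs by blast
  qed
  then show ?thesis using \<Phi> ex1_hs ex1_perm by blast
qed

end
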